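(* Let $(I\times\Omega,\mathcal I\boxtimes\mathcal F,\lambda\boxtimes P)$ be a Fubini extension, let $\mathcal C$ be a countably generated sub-$\sigma$-algebra of $\mathcal F$, and let $f$ be a process from $(I\times\Omega,\mathcal I\boxtimes\mathcal F,\lambda\boxtimes P)$ to a Polish space $X$. If $f$ is essentially pairwise conditionally independent given $\mathcal C$, then $f$ has no individual uncertainty in aggregation given $\mathcal C$; that is, if $\mu$ is a regular conditional distribution of $f$ given $\mathcal I\otimes\mathcal C$, then for $P$-almost all $\omega\in\Omega$, $\lambda f_\omega^{-1}=\int_I\mu_{i\omega}\,d\lambda(i)$.
   Context: All probability spaces are countably additive and complete. $(I,\mathcal I,\lambda)$ is an atomless probability space and $(\Omega,\mathcal F,P)$ is a probability space. A probability space $(I\times\Omega,\mathcal W,Q)$ extending the usual product space $(I\times\Omega,\mathcal I\otimes\mathcal F,\lambda\otimes P)$ is a Fubini extension if for every real-valued $Q$-integrable function $h$ on $(I\times\Omega,\mathcal W)$: (1) $h_i=h(i,\cdot)$ is integrable on $(\Omega,\mathcal F,P)$ for $\lambda$-almost all $i$, and $h_\omega=h(\cdot,\omega)$ is integrable on $(I,\mathcal I,\lambda)$ for $P$-almost all $\omega$; (2) $i\mapsto\int_\Omega h_i\,dP$ and $\omega\mapsto\int_I h_\omega\,d\lambda$ are integrable on $(I,\mathcal I,\lambda)$ and $(\Omega,\mathcal F,P)$ respectively, and $\int h\,dQ=\int_I\int_\Omega h_i\,dP\,d\lambda=\int_\Omega\int_I h_\omega\,d\lambda\,dP$. It is then denoted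 $(I\times\Omega,\mathcal I\boxtimes\mathcal F,\lambda\boxtimes P)$. Sub-$\sigma$-algebras $\mathcal C$ of $\mathcal F$ are assumed to contain all $P$-null sets of $\mathcal F$; "countably generated" means generated by a countable family of sets together with the $P$-null sets. A process from the Fubini extension to a Polish space $X$ (with Borel $\sigma$-algebra $\mathcal B$) is an $\mathcal I\boxtimes\mathcal F$-measurable map $f:I\times\Omega\to X$; write $f_i=f(i,\cdot)$, $f_\omega=f(\cdot,\omega)$. Random variables $\phi,\psi:\Omega\to X$ are conditionally independent given $\mathcal C$ if $P(\phi^{-1}(B_1)\cap\psi^{-1}(B_2)|\mathcal C)=P(\phi^{-1}(B_1)|\mathcal C)P(\psi^{-1}(B_2)|\mathcal C)$ for all $B_1,B_2\in\mathcal B$. The process $f$ is essentially pairwise conditionally independent given $\mathcal C$ if for $\lambda$-almost all $i_1\in I$, $f_{i_1}$ and $f_{i_2}$ are conditionally independent given $\mathcal C$ for $\lambda$-almost all $i_2\in I$. A regular conditional distribution $\mu$ of $f$ given $\mathcal I\otimes\mathcal C$ is taken on the probability space $(I\times\Omega,\mathcal I\boxtimes\mathcal F,\lambda\boxtimes P)$; $\mu_{i\omega}$ is its value at $(i,\omega)$, a Borel probability measure on $X$. $\int_I\mu_{i\omega}\,d\lambda$ is the Borel probability measure $B\mapsto\int_I\mu_{i\omega}(B)\,d\lambda(i)$, and $\lambda f_\omega^{-1}$ is the distribution of $f_\omega$ under $\lambda$. *)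

theory Defs
  imports "HOL-Probability.Probability"
begin

locale complete_prob_space = prob_space M + complete_measure M for M :: "'a measure"

definition atomless :: "'a measure \<Rightarrow> bool" where
  "atomless M \<longleftrightarrow>
     (\<forall>A\<in>sets M. 0 < measure M A \<longrightarrow>
        (\<exists>B\<in>sets M. B \<subseteq> A \<and> 0 < measure M B \<and> measure M B < measure M A))"

text \<open>All probability spaces are taken to be complete, so the usual product is the completion of
  the product measure.\<close>

definition usual_product :: "'i measure \<Rightarrow> 'w measure \<Rightarrow> ('i \<times> 'w) measure" where
  "usual_product \<Lambda> P = completion (\<Lambda> \<Otimes>\<^sub>M P)"

text \<open>The Bochner integral of a non-integrable function is \<open>0\<close> here. In the two iterated integrals
  this only concerns a null set of sections, by the first two Fubini conditions.\<close>

locale fubini_extension =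
  index: complete_prob_space \<Lambda> + sample: complete_prob_space P + joint: complete_prob_space Q
  for \<Lambda> :: "'i measure" and P :: "'w measure" and Q :: "('i \<times> 'w) measure" +
  assumes space_ext: "space Q = space \<Lambda> \<times> space P"
    and sets_ext: "sets (usual_product \<Lambda> P) \<subseteq> sets Q"
    and emeasure_ext:
      "\<And>A. A \<in> sets (usual_product \<Lambda> P) \<Longrightarrow> emeasure Q A = emeasure (usual_product \<Lambda> P) A"
    and AE_integrable_sample:
      "\<And>h :: 'i \<times> 'w \<Rightarrow> real. integrable Q h \<Longrightarrow> AE i in \<Lambda>. integrable P (\<lambda>\<omega>. h (i, \<omega>))"
    and AE_integrable_index:
      "\<And>h :: 'i \<times> 'w \<Rightarrow> real. integrable Q h \<Longrightarrow> AE \<omega> in P. integrable \<Lambda> (\<lambda>i. h (i, \<omega>))"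
    and integrable_integral_sample:
      "\<And>h :: 'i \<times> 'w \<Rightarrow> real. integrable Q h \<Longrightarrow> integrable \<Lambda> (\<lambda>i. \<integral>\<omega>. h (i, \<omega>) \<partial>P)"
    and integrable_integral_index:
      "\<And>h :: 'i \<times> 'w \<Rightarrow> real. integrable Q h \<Longrightarrow> integrable P (\<lambda>\<omega>. \<integral>i. h (i, \<omega>) \<partial>\<Lambda>)"
    and integral_sample_index:
      "\<And>h :: 'i \<times> 'w \<Rightarrow> real. integrable Q h \<Longrightarrow>
         (\<integral>z. h z \<partial>Q) = (\<integral>i. (\<integral>\<omega>. h (i, \<omega>) \<partial>P) \<partial>\<Lambda>)"
    and integral_index_sample:
      "\<And>h :: 'i \<times> 'w \<Rightarrow> real. integrable Q h \<Longrightarrow>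
         (\<integral>z. h z \<partial>Q) = (\<integral>\<omega>. (\<integral>i. h (i, \<omega>) \<partial>\<Lambda>) \<partial>P)"

text \<open>As in \<^const>\<open>subalgebra\<close>, a sub-\<open>\<sigma>\<close>-algebra is represented by a measure of which only the
  space and the measurable sets matter.\<close>

definition sub_sigma_algebra :: "'w measure \<Rightarrow> 'w measure \<Rightarrow> bool" where
  "sub_sigma_algebra P C \<longleftrightarrow> subalgebra P C \<and> null_sets P \<subseteq> sets C"

text \<open>\<^const>\<open>real_cond_exp\<close> is \<open>0\<close> unless its second argument is a subalgebra, so conditioning on
  the product \<open>\<sigma>\<close>-algebra below relies on the following fact.\<close>

lemma (in fubini_extension) subalgebra_usual_product:
  assumes "sub_sigma_algebra P C"
  shows "subalgebra Q (usual_product \<Lambda> (restr_to_subalg P C))"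
proof -
  let ?R = "restr_to_subalg P C"
  have sub: "subalgebra P C" using assms by (simp add: sub_sigma_algebra_def)
  have sC: "sets ?R = sets C" using sub by (simp add: sets_restr_to_subalg)
  have spR: "space ?R = space P" by (simp add: space_restr_to_subalg)
  interpret R: prob_space ?R
    using sub sample.prob_space_axioms by (rule prob_space_restr_to_subalg)
  have id: "(\<lambda>z. z) \<in> (\<Lambda> \<Otimes>\<^sub>M P) \<rightarrow>\<^sub>M (\<Lambda> \<Otimes>\<^sub>M ?R)"
  proof -
    have "(\<lambda>w. w) \<in> P \<rightarrow>\<^sub>M ?R" using sub sC spR unfolding subalgebra_def
      by (auto intro!: measurableI)
    then have "(\<lambda>z. (fst z, snd z)) \<in> (\<Lambda> \<Otimes>\<^sub>M P) \<rightarrow>\<^sub>M (\<Lambda> \<Otimes>\<^sub>M ?R)"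
      by (intro measurable_Pair) (auto intro: measurable_compose)
    then show ?thesis by simp
  qed
  have sm: "A \<in> sets (\<Lambda> \<Otimes>\<^sub>M ?R) \<Longrightarrow> A \<in> sets (\<Lambda> \<Otimes>\<^sub>M P)" for A
    using measurable_sets[OF id, of A] sets.sets_into_space[of A "\<Lambda> \<Otimes>\<^sub>M ?R"]
    by (simp add: space_pair_measure spR Int_absorb2)
  have em: "emeasure (\<Lambda> \<Otimes>\<^sub>M ?R) A = emeasure (\<Lambda> \<Otimes>\<^sub>M P) A" if A: "A \<in> sets (\<Lambda> \<Otimes>\<^sub>M ?R)" for A
  proof -
    have "emeasure (\<Lambda> \<Otimes>\<^sub>M ?R) A = (\<integral>\<^sup>+i. emeasure ?R (Pair i -` A) \<partial>\<Lambda>)"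
      using A by (rule R.emeasure_pair_measure_alt)
    also have "\<dots> = (\<integral>\<^sup>+i. emeasure P (Pair i -` A) \<partial>\<Lambda>)"
      using sets_Pair1[OF A] sub sC by (intro nn_integral_cong emeasure_restr_to_subalg) auto
    also have "\<dots> = emeasure (\<Lambda> \<Otimes>\<^sub>M P) A"
      using sm[OF A] by (rule sample.emeasure_pair_measure_alt[symmetric])
    finally show ?thesis .
  qed
  have "sets (usual_product \<Lambda> ?R) \<subseteq> sets (usual_product \<Lambda> P)"
  proof
    fix A assume "A \<in> sets (usual_product \<Lambda> ?R)"
    then obtain S N N' where "A = S \<union> N" "N \<subseteq> N'" "N' \<in> null_sets (\<Lambda> \<Otimes>\<^sub>M ?R)" "S \<in> sets (\<Lambda> \<Otimes>\<^sub>M ?R)"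
      unfolding usual_product_def by (rule sets_completionE)
    then show "A \<in> sets (usual_product \<Lambda> P)" unfolding usual_product_def
      using sm em by (intro sets_completionI[of A S N N']) (auto simp: null_sets_def)
  qed
  then show ?thesis unfolding subalgebra_def using sets_ext space_ext
    by (auto simp: usual_product_def space_pair_measure spR)
qed

definition countably_generated :: "'w measure \<Rightarrow> 'w measure \<Rightarrow> bool" where
  "countably_generated P C \<longleftrightarrow>
     (\<exists>G. countable G \<and> G \<subseteq> sets C \<and> sets C = sigma_sets (space P) (G \<union> null_sets P))"

definition cond_prob_given :: "'w measure \<Rightarrow> 'w measure \<Rightarrow> 'w set \<Rightarrow> 'w \<Rightarrow> real" where
  "cond_prob_given P C A = real_cond_exp P C (indicator A)"

definition cond_indep ::
    "'w measure \<Rightarrow> 'w measure \<Rightarrow> ('w \<Rightarrow> 'x::polish_space) \<Rightarrow> ('w \<Rightarrow> 'x) \<Rightarrow> bool" where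
  "cond_indep P C \<phi> \<psi> \<longleftrightarrow>
     \<phi> \<in> P \<rightarrow>\<^sub>M borel \<and> \<psi> \<in> P \<rightarrow>\<^sub>M borel \<and>
     (\<forall>B\<^sub>1\<in>sets borel. \<forall>B\<^sub>2\<in>sets borel. AE \<omega> in P.
        cond_prob_given P C ((\<phi> -` B\<^sub>1 \<inter> space P) \<inter> (\<psi> -` B\<^sub>2 \<inter> space P)) \<omega> =
        cond_prob_given P C (\<phi> -` B\<^sub>1 \<inter> space P) \<omega> * cond_prob_given P C (\<psi> -` B\<^sub>2 \<inter> space P) \<omega>)"

definition ess_pairwise_cond_indep ::
    "'i measure \<Rightarrow> 'w measure \<Rightarrow> 'w measure \<Rightarrow> ('i \<times> 'w \<Rightarrow> 'x::polish_space) \<Rightarrow> bool" where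
  "ess_pairwise_cond_indep \<Lambda> P C f \<longleftrightarrow>
     (AE i\<^sub>1 in \<Lambda>. AE i\<^sub>2 in \<Lambda>. cond_indep P C (\<lambda>\<omega>. f (i\<^sub>1, \<omega>)) (\<lambda>\<omega>. f (i\<^sub>2, \<omega>)))"

definition regular_cond_distr ::
    "'a measure \<Rightarrow> 'a measure \<Rightarrow> ('a \<Rightarrow> 'x::polish_space) \<Rightarrow> ('a \<Rightarrow> 'x measure) \<Rightarrow> bool" where
  "regular_cond_distr Q G f \<mu> \<longleftrightarrow>
     \<mu> \<in> G \<rightarrow>\<^sub>M prob_algebra borel \<and>
     (\<forall>B\<in>sets borel. AE z in Q. measure (\<mu> z) B = cond_prob_given Q G (f -` B \<inter> space Q) z)"

text \<open>The Giry bind \<open>\<Lambda> \<bind> (\<lambda>i. \<mu> (i, \<omega>))\<close> below is the mixture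
  \<open>B \<mapsto> \<integral>i. \<mu> (i, \<omega>) B \<partial>\<Lambda>\<close>, see \<open>emeasure_bind\<close>.
  The sections \<open>\<lambda>i. f (i, \<omega>)\<close> and \<open>\<lambda>i. \<mu> (i, \<omega>)\<close> are measurable for almost all \<open>\<omega>\<close> only.\<close>

definition no_individual_uncertainty ::
    "'i measure \<Rightarrow> 'w measure \<Rightarrow> ('i \<times> 'w) measure \<Rightarrow> 'w measure \<Rightarrow>
     ('i \<times> 'w \<Rightarrow> 'x::polish_space) \<Rightarrow> bool" where
  "no_individual_uncertainty \<Lambda> P Q C f \<longleftrightarrow>
     (\<forall>\<mu>. regular_cond_distr Q (usual_product \<Lambda> (restr_to_subalg P C)) f \<mu> \<longrightarrow>
        (AE \<omega> in P. distr \<Lambda> borel (\<lambda>i. f (i, \<omega>)) = \<Lambda> \<bind> (\<lambda>i. \<mu> (i, \<omega>))))"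

end

theory Submission
  imports Defs
begin

text \<open>Fix a Borel set \<open>B\<close>, let \<open>h\<close> be the indicator of the event
  that \<open>f\<close> lies in \<open>B\<close>, let \<open>g z = measure (\<mu> z) B\<close>, and
  let \<open>k = h - g\<close>. On the extension, \<open>g\<close> is a conditional expectation of
  \<open>h\<close> given the product of the index sigma-algebra with \<open>C\<close>. This passes
  to sections: for almost every \<open>i\<close>, \<open>g (i, _)\<close> is a conditional
  expectation of \<open>h (i, _)\<close> given \<open>C\<close>
  (\<open>AE_section_real_cond_exp\<close>). So \<open>k (i, _)\<close> is what remains of an
  indicator after projecting onto \<open>C\<close>, and conditional independence makes
  \<open>k (i, _)\<close> and \<open>k (j, _)\<close> orthogonal in L2(P) for almost all
  \<open>i\<close> and then almost all \<open>j\<close>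
  (\<open>integral_cond_exp_residuals_eq_0\<close>). Hence the average of \<open>k (i, _)\<close>
  over \<open>i\<close> has second moment zero: an exact law of large numbers obtained from the
  Fubini property (\<open>AE_integral_index_eq_0\<close>). This says that for almost all
  \<open>\<omega>\<close> the distribution of the section of \<open>f\<close> and the mixture of the
  \<open>\<mu> (i, \<omega>)\<close> agree on \<open>B\<close>
  (\<open>AE_sample_distribution_eq_average\<close>).

  The exceptional null set depends on \<open>B\<close>. Since the Borel sets are generated by a
  countable pi-system, a single null set serves the whole system, and probability measures that
  agree on a generating pi-system are equal.\<close>

section \<open>Countable pi-systems and integrals over generated sets\<close>

lemma countable_Int_stable_generator:
  assumes "countable G" "G \<subseteq> Pow \<Omega>"
  obtains H where "countable H" "Int_stable H" "G \<subseteq> H" "\<Omega> \<in> H" "H \<subseteq> sigma_sets \<Omega> G"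
proof
  let ?H = "(\<lambda>F. \<Omega> \<inter> \<Inter>F) ` {F. finite F \<and> F \<subseteq> G}"
  interpret sigma_algebra \<Omega> "sigma_sets \<Omega> G" using assms(2) by (rule sigma_algebra_sigma_sets)
  show "countable ?H" using assms(1) by (intro countable_image countable_Collect_finite_subset)
  show "Int_stable ?H"
  proof (rule Int_stableI_image)
    fix F F' assume "F \<in> {F. finite F \<and> F \<subseteq> G}" "F' \<in> {F. finite F \<and> F \<subseteq> G}"
    then show "\<exists>K\<in>{F. finite F \<and> F \<subseteq> G}. (\<Omega> \<inter> \<Inter>F) \<inter> (\<Omega> \<inter> \<Inter>F') = \<Omega> \<inter> \<Inter>K"
      by (intro bexI[of _ "F \<union> F'"]) auto
  qed
  show "G \<subseteq> ?H"
  proof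
    fix A assume "A \<in> G"
    then show "A \<in> ?H" using assms(2) by (intro image_eqI[of _ _ "{A}"]) auto
  qed
  show "\<Omega> \<in> ?H" by (intro image_eqI[of _ _ "{}"]) auto
  have "\<Omega> \<inter> \<Inter>F \<in> sigma_sets \<Omega> G" if "finite F" "F \<subseteq> G" for F
    using that
  proof (induction F)
    case (insert A F)
    then have "A \<in> sigma_sets \<Omega> G" "\<Omega> \<inter> \<Inter>F \<in> sigma_sets \<Omega> G" by auto
    then have "A \<inter> (\<Omega> \<inter> \<Inter>F) \<in> sigma_sets \<Omega> G" by (rule Int)
    also have "A \<inter> (\<Omega> \<inter> \<Inter>F) = \<Omega> \<inter> \<Inter>(insert A F)" by auto
    finally show ?case .
  qed (simp add: top)
  then show "?H \<subseteq> sigma_sets \<Omega> G" by auto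
qed

text \<open>Close a countable basis under finite intersections. Countability allows the union of the
  exceptional null sets to stay null; intersection stability makes agreement on the generator
  sufficient.\<close>

lemma borel_countable_Int_stable_generator:
  obtains H :: "'x::second_countable_topology set set"
  where "countable H" "Int_stable H" "UNIV \<in> H" "sets borel = sigma_sets UNIV H"
proof -
  obtain G :: "'x set set" where G: "countable G" "topological_basis G"
    using ex_countable_basis by blast
  obtain H where H: "countable H" "Int_stable H" "G \<subseteq> H" "UNIV \<in> H" "H \<subseteq> sigma_sets UNIV G"
    using countable_Int_stable_generator[OF G(1), of UNIV] by auto
  have "sets borel = sigma_sets UNIV G"
    unfolding borel_eq_countable_basis[OF G] by (intro sets_measure_of) simp
  also have "\<dots> = sigma_sets UNIV H"
    using H(3,5) by (intro antisym sigma_sets_mono' sigma_sets_mono) auto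
  finally show ?thesis using H that by blast
qed

text \<open>Dynkin's argument: integrability of both functions makes the sets with equal integrals
  closed under complements and countable disjoint unions. Membership of the whole space in
  \<open>G\<close> is what handles complements.\<close>

lemma set_integral_eq_on_generated:
  fixes f g :: "'a \<Rightarrow> real"
  assumes f: "integrable M f" and g: "integrable M g"
    and G: "Int_stable G" "G \<subseteq> sets M" "space M \<in> G"
    and eq: "\<And>A. A \<in> G \<Longrightarrow> (\<integral>x\<in>A. f x \<partial>M) = (\<integral>x\<in>A. g x \<partial>M)"
    and A: "A \<in> sigma_sets (space M) G"
  shows "(\<integral>x\<in>A. f x \<partial>M) = (\<integral>x\<in>A. g x \<partial>M)"
proof -
  have sub: "B \<in> sets M" if "B \<in> sigma_sets (space M) G" for B
    using that G(2) sets.sigma_sets_subset by blast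
  have int: "set_integrable M B h" if "integrable M h" "B \<in> sets M" for B and h :: "'a \<Rightarrow> real"
    unfolding set_integrable_def using that by (intro integrable_mult_indicator)
  have "G \<subseteq> Pow (space M)" using G(2) sets.space_closed by blast
  with G(1) show ?thesis using A
  proof (induction rule: sigma_sets_induct_disjoint)
    case (compl A)
    have *: "(\<integral>x\<in>space M. h x \<partial>M) = (\<integral>x\<in>A. h x \<partial>M) + (\<integral>x\<in>space M - A. h x \<partial>M)"
      if h: "integrable M h" for h :: "'a \<Rightarrow> real"
    proof -
      have A: "A \<in> sets M" using compl(1) by (rule sub)
      have "A \<union> (space M - A) = space M" using sets.sets_into_space[OF A] by auto
      then show ?thesis
        using set_integral_Un[of A "space M - A" M h] int[OF h] A by auto
    qed
    show ?case using *[OF f] *[OF g] eq[OF G(3)] compl(2) by simp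
  next
    case (union F)
    have "(\<integral>x\<in>(\<Union>i. F i). h x \<partial>M) = (\<Sum>i. \<integral>x\<in>F i. h x \<partial>M)" if "integrable M h" for h :: "'a \<Rightarrow> real"
    proof (rule lebesgue_integral_countable_add)
      show F: "F i \<in> sets M" for i using union(2) sub by auto
      show "F i \<inter> F j = {}" if "i \<noteq> j" for i j
        using union(1) that by (auto simp: disjoint_family_on_def)
      show "set_integrable M (\<Union>i. F i) h" using F by (intro int[OF that]) auto
    qed
    then show ?case using f g union(3) by simp
  qed (simp_all add: eq, simp add: set_lebesgue_integral_def)
qed

section \<open>Conditional expectation given a sub-sigma-algebra\<close>

lemma sub_sigma_algebra_sigma_finite:
  assumes "prob_space P" "sub_sigma_algebra P C"
  shows "sigma_finite_subalgebra P C"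
  using assms
  by (intro finite_measure_subalgebra_is_sigma_finite)
    (simp add: sub_sigma_algebra_def finite_measure_subalgebra_def
      finite_measure_subalgebra_axioms_def prob_space_def)

text \<open>Expand the product into four terms. With \<open>a\<close> and \<open>b\<close> the two
  conditional expectations, both mixed terms integrate to the integral of \<open>a * b\<close>,
  because \<open>a\<close> and \<open>b\<close> are \<open>F\<close>-measurable. By the product
  hypothesis the indicator of \<open>A \<inter> B\<close> has that integral too, so everything
  cancels.\<close>

lemma (in sigma_finite_subalgebra) integral_cond_exp_residuals_eq_0:
  assumes A: "A \<in> sets M" "emeasure M A < \<infinity>" and B: "B \<in> sets M" "emeasure M B < \<infinity>"
    and AB: "AE x in M. real_cond_exp M F (indicator (A \<inter> B)) x =
      real_cond_exp M F (indicator A) x * real_cond_exp M F (indicator B) x"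
  shows "(\<integral>x. (indicator A x - real_cond_exp M F (indicator A) x) *
    (indicator B x - real_cond_exp M F (indicator B) x) \<partial>M) = 0"
proof -
  define a b where "a = real_cond_exp M F (indicator A)" and "b = real_cond_exp M F (indicator B)"
  have iA: "integrable M (indicator A :: _ \<Rightarrow> real)" and iB: "integrable M (indicator B :: _ \<Rightarrow> real)"
    using A B by (auto intro: integrable_real_indicator)
  have iAB: "integrable M (indicator (A \<inter> B) :: _ \<Rightarrow> real)"
    using A B by (metis Int_lower1 emeasure_mono integrable_real_indicator order_le_less_trans sets.Int)
  have meas: "a \<in> borel_measurable F" "b \<in> borel_measurable F"
    by (simp_all add: a_def b_def)
  have ia: "integrable M a" and ib: "integrable M b"
    using real_cond_exp_int(1)[OF iA] real_cond_exp_int(1)[OF iB] by (simp_all add: a_def b_def)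
  have aB: "integrable M (\<lambda>x. a x * indicator B x)" "integrable M (\<lambda>x. b x * indicator A x)"
    using integrable_real_mult_indicator[OF B(1) ia] integrable_real_mult_indicator[OF A(1) ib] .
  have i1: "integrable M (\<lambda>x. a x * b x)" "(\<integral>x. a x * b x \<partial>M) = (\<integral>x. a x * indicator B x \<partial>M)"
    using real_cond_exp_intg[OF aB(1) meas(1)] B by (simp_all add: b_def)
  have i2: "(\<integral>x. b x * a x \<partial>M) = (\<integral>x. b x * indicator A x \<partial>M)"
    using real_cond_exp_intg[OF aB(2) meas(2)] A by (simp add: a_def)
  have "(\<integral>x. indicator (A \<inter> B) x \<partial>M) = (\<integral>x. real_cond_exp M F (indicator (A \<inter> B)) x \<partial>M)"
    using real_cond_exp_int(2)[OF iAB] by simp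
  also have "\<dots> = (\<integral>x. a x * b x \<partial>M)"
    using AB i1(1) by (intro integral_cong_AE) (auto simp: a_def b_def)
  finally have i3: "(\<integral>x. indicator (A \<inter> B) x \<partial>M) = (\<integral>x. a x * b x \<partial>M)" .
  have "(\<integral>x. (indicator A x - a x) * (indicator B x - b x) \<partial>M) =
      (\<integral>x. (indicator (A \<inter> B) x - a x * indicator B x) - (b x * indicator A x - a x * b x) \<partial>M)"
    by (intro Bochner_Integration.integral_cong)
      (auto simp: indicator_inter_arith algebra_simps)
  also have "\<dots> = 0"
    using iAB aB i1 i2 i3 by (simp add: mult.commute)
  finally show ?thesis by (simp add: a_def b_def)
qed

section \<open>Sections in a Fubini extension\<close>

context fubini_extension
begin

lemma sets_pair_subset: "sets (\<Lambda> \<Otimes>\<^sub>M P) \<subseteq> sets Q"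
  using sets_ext by (auto simp: usual_product_def)

lemma measurable_pair_ext: "g \<in> (\<Lambda> \<Otimes>\<^sub>M P) \<rightarrow>\<^sub>M N \<Longrightarrow> g \<in> Q \<rightarrow>\<^sub>M N"
  using sets_pair_subset space_ext by (auto simp: measurable_def space_pair_measure)

text \<open>The Fubini property for \<open>h\<close> cut off to a rectangle. It lets identities of
  integrals over rectangles be read as identities between functions of \<open>i\<close>.\<close>

lemma set_integral_times:
  fixes h :: "'i \<times> 'w \<Rightarrow> real"
  assumes h: "integrable Q h" and A: "A \<in> sets \<Lambda>" and K: "K \<in> sets P"
  shows "(\<integral>i\<in>A. (\<integral>\<omega>\<in>K. h (i, \<omega>) \<partial>P) \<partial>\<Lambda>) = (\<integral>z\<in>A \<times> K. h z \<partial>Q)"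
    and "integrable \<Lambda> (\<lambda>i. \<integral>\<omega>\<in>K. h (i, \<omega>) \<partial>P)"
proof -
  have int: "integrable Q (\<lambda>z. indicator (B \<times> K) z *\<^sub>R h z)" if "B \<in> sets \<Lambda>" for B
    using that K sets_pair_subset by (intro integrable_mult_indicator h) auto
  show "(\<integral>i\<in>A. (\<integral>\<omega>\<in>K. h (i, \<omega>) \<partial>P) \<partial>\<Lambda>) = (\<integral>z\<in>A \<times> K. h z \<partial>Q)"
    unfolding set_lebesgue_integral_def integral_sample_index[OF int[OF A]]
    by (simp add: indicator_times mult.assoc)
  have "integrable \<Lambda> (\<lambda>i. \<integral>\<omega>. indicator (space \<Lambda> \<times> K) (i, \<omega>) *\<^sub>R h (i, \<omega>) \<partial>P)"
    using integrable_integral_sample[OF int] by simp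
  then show "integrable \<Lambda> (\<lambda>i. \<integral>\<omega>\<in>K. h (i, \<omega>) \<partial>P)"
    unfolding set_lebesgue_integral_def
    by (rule iffD1[OF Bochner_Integration.integrable_cong, rotated 2])
      (simp_all add: indicator_times)
qed

text \<open>This is where countable generation enters: for each set of a countable generator the identity
  of the sectional integrals fails on a null set of indices only.\<close>

lemma AE_section_real_cond_exp:
  fixes g h :: "'i \<times> 'w \<Rightarrow> real"
  assumes C: "sub_sigma_algebra P C" "countably_generated P C" and h: "integrable Q h"
    and g_meas: "g \<in> borel_measurable (usual_product \<Lambda> (restr_to_subalg P C))"
    and g_eq: "AE z in Q. g z = real_cond_exp Q (usual_product \<Lambda> (restr_to_subalg P C)) h z"
  shows "AE i in \<Lambda>. AE \<omega> in P. g (i, \<omega>) = real_cond_exp P C (\<lambda>\<omega>. h (i, \<omega>)) \<omega>"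
proof -
  let ?R = "restr_to_subalg P C"
  let ?G = "usual_product \<Lambda> ?R"
  have subalg: "subalgebra P C" using C(1) by (simp add: sub_sigma_algebra_def)
  have sets_R: "sets ?R = sets C" and space_R: "space ?R = space P"
    using subalg by (simp_all add: sets_restr_to_subalg space_restr_to_subalg)
  interpret R: prob_space ?R
    using subalg sample.prob_space_axioms by (rule prob_space_restr_to_subalg)
  interpret LR: pair_sigma_finite \<Lambda> ?R ..
  interpret Q: sigma_finite_subalgebra Q ?G
    using subalgebra_usual_product[OF C(1)] joint.prob_space_axioms
    by (intro finite_measure_subalgebra_is_sigma_finite)
      (simp add: finite_measure_subalgebra_def finite_measure_subalgebra_axioms_def prob_space_def)
  interpret P: sigma_finite_subalgebra P C
    using sample.prob_space_axioms C(1) by (rule sub_sigma_algebra_sigma_finite)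
  have g_Q: "g \<in> borel_measurable Q" by (rule measurable_from_subalg[OF Q.subalg g_meas])
  have g: "integrable Q g"
    using Q.real_cond_exp_int(1)[OF h] g_Q g_eq by (rule integrable_cong_AE_imp[OF _ _ AE_symmetric])
  \<comment> \<open>\<open>g\<close> is measurable only for the completed product, so a single
    section of it need not be \<open>C\<close>-measurable. Sections of the version
    \<open>g'\<close>, measurable before completion, always are.\<close>
  obtain g' where g': "g' \<in> borel_measurable (\<Lambda> \<Otimes>\<^sub>M ?R)"
      and gg': "AE z in \<Lambda> \<Otimes>\<^sub>M ?R. g z = g' z"
    using completion_ex_borel_measurable_real[of g] g_meas unfolding usual_product_def by blast
  have sec: "AE i in \<Lambda>. AE \<omega> in P. g (i, \<omega>) = g' (i, \<omega>)"
    using LR.AE_pair[OF gg'] by eventually_elim (rule AE_restr_to_subalg[OF subalg])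
  obtain G where G: "countable G" "G \<subseteq> sets C" "sets C = sigma_sets (space P) (G \<union> null_sets P)"
    using C(2) by (auto simp: countably_generated_def)
  have space_C: "space C = space P" and sets_C: "sets C \<subseteq> sets P"
    using subalg by (auto simp: subalgebra_def)
  have GP: "G \<subseteq> Pow (space P)" using G(2) sets.space_closed[of C] space_C by auto
  \<comment> \<open>The null sets, possibly uncountably many, stay outside \<open>H\<close>; they
    are added back only once \<open>i\<close> is fixed.\<close>
  obtain H where H: "countable H" "Int_stable H" "G \<subseteq> H" "space P \<in> H"
      "H \<subseteq> sigma_sets (space P) G"
    using countable_Int_stable_generator[OF G(1) GP] by blast
  have HC: "H \<subseteq> sets C"
    using H(5) sets.sigma_sets_subset[OF G(2)] space_C by auto
  \<comment> \<open>For fixed \<open>K\<close>, each rectangle \<open>A \<times> K\<close> lies in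
    the conditioning sigma-algebra, so the two functions of \<open>i\<close> have equal integrals
    over every \<open>A\<close> and therefore agree almost everywhere.\<close>
  have "AE i in \<Lambda>. (\<integral>\<omega>\<in>K. h (i, \<omega>) \<partial>P) = (\<integral>\<omega>\<in>K. g (i, \<omega>) \<partial>P)" if K: "K \<in> H" for K
  proof (rule density_unique_real)
    have KC: "K \<in> sets C" and KP: "K \<in> sets P" using K HC sets_C by auto
    show "integrable \<Lambda> (\<lambda>i. \<integral>\<omega>\<in>K. h (i, \<omega>) \<partial>P)" "integrable \<Lambda> (\<lambda>i. \<integral>\<omega>\<in>K. g (i, \<omega>) \<partial>P)"
      using set_integral_times(2)[OF _ sets.top KP] h g by auto
    fix A assume A: "A \<in> sets \<Lambda>"
    then have "A \<times> K \<in> sets (\<Lambda> \<Otimes>\<^sub>M ?R)" using KC sets_R by auto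
    then have AK: "A \<times> K \<in> sets ?G" by (simp add: usual_product_def)
    have AKQ: "A \<times> K \<in> sets Q" using A KP sets_pair_subset by auto
    have "(\<integral>z\<in>A \<times> K. h z \<partial>Q) = (\<integral>z\<in>A \<times> K. g z \<partial>Q)"
      unfolding Q.real_cond_exp_intA[OF h AK] unfolding set_lebesgue_integral_def
    proof (rule integral_cong_AE)
      show "AE z in Q. indicator (A \<times> K) z *\<^sub>R real_cond_exp Q ?G h z = indicator (A \<times> K) z *\<^sub>R g z"
        using g_eq by eventually_elim simp
    qed (use g_Q AKQ in simp_all)
    then show "(\<integral>i\<in>A. (\<integral>\<omega>\<in>K. h (i, \<omega>) \<partial>P) \<partial>\<Lambda>) = (\<integral>i\<in>A. (\<integral>\<omega>\<in>K. g (i, \<omega>) \<partial>P) \<partial>\<Lambda>)"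
      by (simp add: set_integral_times(1)[OF h A KP] set_integral_times(1)[OF g A KP])
  qed
  then have "AE i in \<Lambda>. \<forall>K\<in>H. (\<integral>\<omega>\<in>K. h (i, \<omega>) \<partial>P) = (\<integral>\<omega>\<in>K. g (i, \<omega>) \<partial>P)"
    by (simp add: AE_ball_countable[OF H(1)])
  with sec AE_integrable_sample[OF h] AE_integrable_sample[OF g] AE_space
  show ?thesis
  proof eventually_elim
    case (elim i)
    have "(\<lambda>\<omega>. g' (i, \<omega>)) \<in> borel_measurable ?R"
      using g' elim(4) by (rule measurable_Pair2)
    then have g'C: "(\<lambda>\<omega>. g' (i, \<omega>)) \<in> borel_measurable C"
      using sets_R space_R space_C by (simp cong: measurable_cong_sets)
    have g'P: "(\<lambda>\<omega>. g' (i, \<omega>)) \<in> borel_measurable P" by (rule measurable_from_subalg[OF subalg g'C])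
    have int: "integrable P (\<lambda>\<omega>. g' (i, \<omega>))"
      using elim(3) g'P elim(1) by (rule integrable_cong_AE_imp)
    have N: "(\<integral>\<omega>\<in>A. u \<omega> \<partial>P) = 0" if "A \<in> null_sets P" for A and u :: "'w \<Rightarrow> real"
      unfolding set_lebesgue_integral_def using AE_not_in[OF that]
      by (intro integral_eq_zero_AE) auto
    \<comment> \<open>Extend from \<open>H\<close> and the null sets, over which both integrals
      vanish, to all of \<open>C\<close>. With \<open>C\<close>-measurability of the section of
      \<open>g'\<close>, this characterizes the conditional expectation.\<close>
    have "(\<integral>\<omega>\<in>A. h (i, \<omega>) \<partial>P) = (\<integral>\<omega>\<in>A. g' (i, \<omega>) \<partial>P)" if A: "A \<in> sets C" for A
    proof (rule set_integral_eq_on_generated[where G="H \<union> null_sets P"])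
      show "Int_stable (H \<union> null_sets P)"
        using H(2) HC sets_C
        by (auto simp: Int_stable_def intro: null_set_Int1 null_set_Int2)
      show "H \<union> null_sets P \<subseteq> sets P" using HC sets_C by auto
      have "sigma_sets (space P) (G \<union> null_sets P) \<subseteq> sigma_sets (space P) (H \<union> null_sets P)"
        using H(3) by (intro sigma_sets_mono') auto
      then show "A \<in> sigma_sets (space P) (H \<union> null_sets P)" using A G(3) by auto
      fix K assume K: "K \<in> H \<union> null_sets P"
      show "(\<integral>\<omega>\<in>K. h (i, \<omega>) \<partial>P) = (\<integral>\<omega>\<in>K. g' (i, \<omega>) \<partial>P)"
      proof (cases "K \<in> H")
        case True
        then have "(\<integral>\<omega>\<in>K. h (i, \<omega>) \<partial>P) = (\<integral>\<omega>\<in>K. g (i, \<omega>) \<partial>P)" using elim by auto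
        also have "\<dots> = (\<integral>\<omega>\<in>K. g' (i, \<omega>) \<partial>P)"
        proof -
          have [measurable]: "K \<in> sets P" using True HC sets_C by auto
          have [measurable]: "(\<lambda>\<omega>. g (i, \<omega>)) \<in> borel_measurable P" using elim(3) by auto
          note g'P[measurable]
          show ?thesis unfolding set_lebesgue_integral_def
            using elim(1) by (intro integral_cong_AE) auto
        qed
        finally show ?thesis .
      qed (use K N in auto)
    qed (use elim int H(4) in auto)
    then have "AE \<omega> in P. real_cond_exp P C (\<lambda>\<omega>. h (i, \<omega>)) \<omega> = g' (i, \<omega>)"
      using elim(2) int g'C by (rule P.real_cond_exp_charact)
    with elim(1) show ?case by eventually_elim simp
  qed
qed

text \<open>With \<open>D \<omega> = \<integral>i. k (i, \<omega>) \<partial>\<Lambda>\<close>, exchanging the order of integration twice turns the second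
  moment of \<open>D\<close> into the average over \<open>i\<close> and \<open>j\<close> of the inner products of the sections \<open>k\<^sub>i\<close> and \<open>k\<^sub>j\<close>.
  Only products of \<open>k\<close> with a function of \<open>\<omega>\<close> alone are integrated over the extension, so no measurability
  of \<open>(i, j, \<omega>) \<mapsto> k (i, \<omega>) * k (j, \<omega>)\<close> is required.\<close>

lemma AE_integral_index_eq_0:
  fixes k :: "'i \<times> 'w \<Rightarrow> real"
  assumes k: "k \<in> borel_measurable Q" and bound: "\<And>z. z \<in> space Q \<Longrightarrow> \<bar>k z\<bar> \<le> c"
    and orth: "AE i in \<Lambda>. AE j in \<Lambda>. (\<integral>\<omega>. k (i, \<omega>) * k (j, \<omega>) \<partial>P) = 0"
  shows "AE \<omega> in P. (\<integral>i. k (i, \<omega>) \<partial>\<Lambda>) = 0"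
proof -
  define D where "D = (\<lambda>\<omega>. \<integral>i. k (i, \<omega>) \<partial>\<Lambda>)"
  \<comment> \<open>Used with \<open>u = D\<close> and with \<open>u\<close> a section of
    \<open>k\<close>, both bounded by the same \<open>c\<close>.\<close>
  have int_mult: "integrable Q (\<lambda>z. k z * u (snd z))"
    if u: "u \<in> borel_measurable P" and ub: "\<And>\<omega>. \<omega> \<in> space P \<Longrightarrow> \<bar>u \<omega>\<bar> \<le> c" for u
  proof (rule joint.integrable_const_bound)
    have "(\<lambda>z. u (snd z)) \<in> borel_measurable Q"
      using u by (intro measurable_pair_ext measurable_compose[OF measurable_snd])
    with k show "(\<lambda>z. k z * u (snd z)) \<in> borel_measurable Q" by (rule borel_measurable_times)
    show "AE z in Q. norm (k z * u (snd z)) \<le> c * c"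
    proof (rule AE_I2)
      fix z assume z: "z \<in> space Q"
      then have "snd z \<in> space P" by (auto simp: space_ext)
      moreover have "0 \<le> c" using bound[OF z] by linarith
      ultimately have "\<bar>k z\<bar> * \<bar>u (snd z)\<bar> \<le> c * c"
        by (intro mult_mono bound[OF z] ub abs_ge_zero)
      then show "norm (k z * u (snd z)) \<le> c * c" by (simp add: abs_mult)
    qed
  qed
  have ik: "integrable Q k"
    using bound k by (intro joint.integrable_const_bound[of _ c] AE_I2) auto
  have D: "D \<in> borel_measurable P"
    using integrable_integral_index[OF ik] by (auto simp: D_def)
  have Db: "\<bar>D \<omega>\<bar> \<le> c" if w: "\<omega> \<in> space P" for \<omega>
  proof (cases "integrable \<Lambda> (\<lambda>i. k (i, \<omega>))")
    case True
    have "\<bar>D \<omega>\<bar> \<le> (\<integral>i. \<bar>k (i, \<omega>)\<bar> \<partial>\<Lambda>)" unfolding D_def by (rule integral_abs_bound)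
    also have "\<dots> \<le> (\<integral>i. c \<partial>\<Lambda>)"
      using True bound w space_ext by (intro integral_mono) auto
    finally show ?thesis by (simp add: index.prob_space)
  next
    case False
    \<comment> \<open>Here \<open>D \<omega>\<close> is the default value 0, so only
      \<open>0 \<le> c\<close> is needed; the bound at any one point gives it.\<close>
    obtain i where "i \<in> space \<Lambda>" using index.not_empty by auto
    then have "0 \<le> c" using bound[of "(i, \<omega>)"] w space_ext by auto
    then show ?thesis using False by (simp add: D_def not_integrable_integral_eq)
  qed
  have iD: "integrable Q (\<lambda>z. k z * D (snd z))" using D Db by (rule int_mult)
  have inner: "AE i in \<Lambda>. (\<integral>\<omega>. k (i, \<omega>) * D \<omega> \<partial>P) = 0"
    using orth AE_integrable_sample[OF ik] AE_space
  proof eventually_elim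
    case (elim i)
    have int: "integrable Q (\<lambda>z. k z * k (i, snd z))"
      using elim bound space_ext by (intro int_mult) auto
    have "(\<integral>\<omega>. k (i, \<omega>) * D \<omega> \<partial>P) = (\<integral>\<omega>. (\<integral>j. k (j, \<omega>) * k (i, \<omega>) \<partial>\<Lambda>) \<partial>P)"
      by (simp add: D_def mult.commute)
    also have "\<dots> = (\<integral>j. (\<integral>\<omega>. k (j, \<omega>) * k (i, \<omega>) \<partial>P) \<partial>\<Lambda>)"
      using integral_index_sample[OF int] integral_sample_index[OF int] by simp
    also have "\<dots> = 0"
      using elim(1) by (intro integral_eq_zero_AE) (simp add: mult.commute)
    finally show ?case .
  qed
  have "(\<integral>\<omega>. D \<omega> * D \<omega> \<partial>P) = (\<integral>\<omega>. (\<integral>i. k (i, \<omega>) * D \<omega> \<partial>\<Lambda>) \<partial>P)"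
    by (simp add: D_def)
  also have "\<dots> = (\<integral>i. (\<integral>\<omega>. k (i, \<omega>) * D \<omega> \<partial>P) \<partial>\<Lambda>)"
    using integral_index_sample[OF iD] integral_sample_index[OF iD] by simp
  also have "\<dots> = 0"
    using inner by (rule integral_eq_zero_AE)
  finally have "(\<integral>\<omega>. D \<omega> * D \<omega> \<partial>P) = 0" .
  moreover have "integrable P (\<lambda>\<omega>. D \<omega> * D \<omega>)"
    using integrable_integral_index[OF iD] by (simp add: D_def)
  ultimately have "AE \<omega> in P. D \<omega> * D \<omega> = 0"
    using integral_nonneg_eq_0_iff_AE[of P "\<lambda>\<omega>. D \<omega> * D \<omega>"] by simp
  then show ?thesis by (simp add: D_def)
qed

text \<open>The argument for a single Borel set. Measurability and integrability of the sections are
  part of the conclusion because they hold only for almost all \<open>\<omega>\<close>, and the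
  distribution and the mixture are later built from them.\<close>

lemma AE_sample_distribution_eq_average:
  fixes f :: "'i \<times> 'w \<Rightarrow> 'x::polish_space"
  assumes C: "sub_sigma_algebra P C" "countably_generated P C"
    and f: "f \<in> Q \<rightarrow>\<^sub>M borel" and indep: "ess_pairwise_cond_indep \<Lambda> P C f"
    and \<mu>: "regular_cond_distr Q (usual_product \<Lambda> (restr_to_subalg P C)) f \<mu>"
    and B: "B \<in> sets borel"
  shows "AE \<omega> in P. (\<lambda>i. f (i, \<omega>)) -` B \<inter> space \<Lambda> \<in> sets \<Lambda> \<and>
    integrable \<Lambda> (\<lambda>i. measure (\<mu> (i, \<omega>)) B) \<and>
    measure \<Lambda> ((\<lambda>i. f (i, \<omega>)) -` B \<inter> space \<Lambda>) = (\<integral>i. measure (\<mu> (i, \<omega>)) B \<partial>\<Lambda>)"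
proof -
  let ?G = "usual_product \<Lambda> (restr_to_subalg P C)"
  define h g :: "'i \<times> 'w \<Rightarrow> real"
    where "h = indicator (f -` B \<inter> space Q)" and "g = (\<lambda>z. measure (\<mu> z) B)"
  define k where "k = (\<lambda>z. h z - g z)"
  interpret C: sigma_finite_subalgebra P C
    using sample.prob_space_axioms C(1) by (rule sub_sigma_algebra_sigma_finite)
  have subalg: "subalgebra Q ?G" using C(1) by (rule subalgebra_usual_product)
  have \<mu>_meas: "\<mu> \<in> ?G \<rightarrow>\<^sub>M prob_algebra borel"
    and g_eq: "AE z in Q. g z = real_cond_exp Q ?G h z"
    using \<mu> B by (auto simp: regular_cond_distr_def cond_prob_given_def g_def h_def)
  have g_meas: "g \<in> borel_measurable ?G"
    unfolding g_def using \<mu>_meas measurable_measure_prob_algebra[OF B] by (rule measurable_compose)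
  then have g_Q: "g \<in> borel_measurable Q" by (rule measurable_from_subalg[OF subalg])
  have g_bound: "0 \<le> g z \<and> g z \<le> 1" if "z \<in> space Q" for z
  proof -
    have "\<mu> z \<in> space (prob_algebra borel)"
      using \<mu>_meas that subalg by (auto simp: subalgebra_def dest: measurable_space)
    then interpret prob_space "\<mu> z" by (simp add: space_prob_algebra)
    show ?thesis by (simp add: g_def)
  qed
  have h: "integrable Q h"
    unfolding h_def using measurable_sets[OF f B]
    by (intro integrable_real_indicator) (auto simp: less_top[symmetric])
  have g: "integrable Q g"
    using g_Q g_bound by (intro joint.integrable_const_bound[of _ 1] AE_I2) auto
  have h_section: "(\<lambda>\<omega>. h (i, \<omega>)) = indicator ((\<lambda>\<omega>. f (i, \<omega>)) -` B \<inter> space P)"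
    if "i \<in> space \<Lambda>" for i
    using that by (auto simp: h_def space_ext indicator_def)
  have sec: "AE i in \<Lambda>. AE \<omega> in P. g (i, \<omega>) = real_cond_exp P C (\<lambda>\<omega>. h (i, \<omega>)) \<omega>"
    using C h g_meas g_eq by (rule AE_section_real_cond_exp)
  have k_sections: "AE i in \<Lambda>. (\<lambda>\<omega>. k (i, \<omega>)) \<in> borel_measurable P"
    using AE_integrable_sample[OF Bochner_Integration.integrable_diff[OF h g]]
    by eventually_elim (auto simp: k_def)
  have orth: "AE i in \<Lambda>. AE j in \<Lambda>. (\<integral>\<omega>. k (i, \<omega>) * k (j, \<omega>) \<partial>P) = 0"
    using indep[unfolded ess_pairwise_cond_indep_def] sec k_sections AE_space
  proof eventually_elim
    case i: (elim i)
    show ?case using i(1) sec k_sections AE_space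
    proof eventually_elim
      case j: (elim j)
      define S where "S = (\<lambda>i. (\<lambda>\<omega>. f (i, \<omega>)) -` B \<inter> space P)"
      have S: "S i \<in> sets P" "S j \<in> sets P"
        using j(1) B by (auto simp: cond_indep_def S_def intro: measurable_sets)
      \<comment> \<open>Stated for a general index \<open>l\<close>, as it is needed at both
        \<open>i\<close> and \<open>j\<close>.\<close>
      have eq: "AE \<omega> in P. k (l, \<omega>) = indicator (S l) \<omega> - real_cond_exp P C (indicator (S l)) \<omega>"
        if "l \<in> space \<Lambda>" "AE \<omega> in P. g (l, \<omega>) = real_cond_exp P C (\<lambda>\<omega>. h (l, \<omega>)) \<omega>" for l
        using that(2)
      proof eventually_elim
        case (elim \<omega>)
        then show ?case
          using fun_cong[OF h_section[OF that(1)], of \<omega>] h_section[OF that(1)] by (simp add: k_def S_def)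
      qed
      have "(\<integral>\<omega>. k (i, \<omega>) * k (j, \<omega>) \<partial>P) =
          (\<integral>\<omega>. (indicator (S i) \<omega> - real_cond_exp P C (indicator (S i)) \<omega>) *
            (indicator (S j) \<omega> - real_cond_exp P C (indicator (S j)) \<omega>) \<partial>P)"
        using eq[OF i(4) i(2)] eq[OF j(4) j(2)] i(3) j(3) S
        by (intro integral_cong_AE) auto
      \<comment> \<open>Conditional independence enters here, with both Borel sets equal to
        \<open>B\<close>.\<close>
      also have "\<dots> = 0"
        using S j(1) B
        by (intro C.integral_cond_exp_residuals_eq_0)
          (auto simp: cond_indep_def cond_prob_given_def S_def less_top[symmetric])
      finally show ?case .
    qed
  qed
  have "AE \<omega> in P. (\<integral>i. k (i, \<omega>) \<partial>\<Lambda>) = 0"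
  proof (rule AE_integral_index_eq_0[OF _ _ orth])
    show "k \<in> borel_measurable Q" using h g by (auto simp: k_def)
    show "\<bar>k z\<bar> \<le> 1" if "z \<in> space Q" for z
      using g_bound[OF that] by (auto simp: k_def h_def indicator_def)
  qed
  with AE_integrable_index[OF h] AE_integrable_index[OF g] AE_space
  show ?thesis
  proof eventually_elim
    case (elim \<omega>)
    let ?T = "(\<lambda>i. f (i, \<omega>)) -` B \<inter> space \<Lambda>"
    have T: "(\<lambda>i. h (i, \<omega>)) = indicator ?T"
      using elim(3) by (auto simp: h_def space_ext indicator_def)
    \<comment> \<open>The indicator of \<open>?T\<close> is an integrable section of
      \<open>h\<close>, which yields measurability of \<open>?T\<close> itself.\<close>
    have "(indicator ?T :: 'i \<Rightarrow> real) \<in> borel_measurable \<Lambda>"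
      using elim(1) unfolding T by auto
    then have "?T \<in> sets \<Lambda>" by (simp add: borel_measurable_indicator_iff Int_assoc)
    moreover have "(\<integral>i. h (i, \<omega>) \<partial>\<Lambda>) = measure \<Lambda> ?T"
      unfolding T by (simp add: Int_assoc)
    ultimately show ?case using elim by (simp add: k_def g_def)
  qed
qed

end

section \<open>From a countable pi-system to equality of measures\<close>

theorem theorem1:
  fixes \<Lambda> :: "'i measure" and P :: "'w measure" and Q :: "('i \<times> 'w) measure"
    and C :: "'w measure" and f :: "'i \<times> 'w \<Rightarrow> 'x::polish_space"
  assumes "atomless \<Lambda>"
    and "fubini_extension \<Lambda> P Q"
    and "sub_sigma_algebra P C" and "countably_generated P C"
    and "f \<in> Q \<rightarrow>\<^sub>M borel"
    and "ess_pairwise_cond_indep \<Lambda> P C f"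
  shows "no_individual_uncertainty \<Lambda> P Q C f"
  unfolding no_individual_uncertainty_def
proof (intro allI impI)
  let ?G = "usual_product \<Lambda> (restr_to_subalg P C)"
  fix \<mu> assume \<mu>: "regular_cond_distr Q ?G f \<mu>"
  interpret fubini_extension \<Lambda> P Q by fact
  obtain H :: "'x set set" where H: "countable H" "Int_stable H" "UNIV \<in> H"
      "sets borel = sigma_sets UNIV H"
    using borel_countable_Int_stable_generator by blast
  have "AE \<omega> in P. \<forall>B\<in>H. (\<lambda>i. f (i, \<omega>)) -` B \<inter> space \<Lambda> \<in> sets \<Lambda> \<and>
      integrable \<Lambda> (\<lambda>i. measure (\<mu> (i, \<omega>)) B) \<and>
      measure \<Lambda> ((\<lambda>i. f (i, \<omega>)) -` B \<inter> space \<Lambda>) = (\<integral>i. measure (\<mu> (i, \<omega>)) B \<partial>\<Lambda>)"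
    unfolding AE_ball_countable[OF H(1)]
    using AE_sample_distribution_eq_average[OF assms(3-6) \<mu>] H(4) by blast
  with AE_space show "AE \<omega> in P. distr \<Lambda> borel (\<lambda>i. f (i, \<omega>)) = \<Lambda> \<bind> (\<lambda>i. \<mu> (i, \<omega>))"
  proof eventually_elim
    case (elim \<omega>)
    have \<mu>_space: "prob_space (\<mu> (i, \<omega>)) \<and> sets (\<mu> (i, \<omega>)) = sets borel" if "i \<in> space \<Lambda>" for i
    proof -
      have "(i, \<omega>) \<in> space ?G"
        using subalgebra_usual_product[OF assms(3)] that elim(1) space_ext
        by (auto simp: subalgebra_def)
      then have "\<mu> (i, \<omega>) \<in> space (prob_algebra borel)"
        using \<mu> unfolding regular_cond_distr_def by (blast dest: measurable_space)
      then show ?thesis by (simp add: space_prob_algebra)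
    qed
    have emeasure_\<mu>: "emeasure (\<mu> (i, \<omega>)) B = ennreal (measure (\<mu> (i, \<omega>)) B)"
      if "i \<in> space \<Lambda>" for i B
      using \<mu>_space[OF that] by (simp add: prob_space_def finite_measure.emeasure_eq_measure)
    have f_meas: "(\<lambda>i. f (i, \<omega>)) \<in> \<Lambda> \<rightarrow>\<^sub>M borel"
      using elim(2) by (intro measurable_sigma_sets[OF H(4)]) auto
    \<comment> \<open>Measurability of \<open>\<mu>\<close> for the completed product does not pass
      to every section. It is recovered at this \<open>\<omega>\<close> from the sets of
      \<open>H\<close>, so that the formula for the bind applies.\<close>
    have "(\<lambda>i. \<mu> (i, \<omega>)) \<in> \<Lambda> \<rightarrow>\<^sub>M prob_algebra borel"
    proof (rule measurable_prob_algebra_generated[OF H(4,2)])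
      fix B assume B: "B \<in> H"
      show "(\<lambda>i. emeasure (\<mu> (i, \<omega>)) B) \<in> borel_measurable \<Lambda>"
        using elim(2) B by (subst measurable_cong[OF emeasure_\<mu>]) auto
    qed (use \<mu>_space in auto)
    then have \<mu>_meas: "(\<lambda>i. \<mu> (i, \<omega>)) \<in> \<Lambda> \<rightarrow>\<^sub>M subprob_algebra borel"
      by (rule measurable_prob_algebraD)
    show ?case
    \<comment> \<open>As \<open>UNIV\<close> belongs to \<open>H\<close> and has finite measure, a
      constant sequence exhausts the space.\<close>
    proof (rule measure_eqI_generator_eq[OF H(2), where \<Omega>=UNIV and A="\<lambda>_. UNIV"])
      fix B assume B: "B \<in> H"
      then have Bb: "B \<in> sets borel" using H(4) by auto
      have "emeasure (\<Lambda> \<bind> (\<lambda>i. \<mu> (i, \<omega>))) B = (\<integral>\<^sup>+i. emeasure (\<mu> (i, \<omega>)) B \<partial>\<Lambda>)"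
        by (rule emeasure_bind[OF index.not_empty \<mu>_meas Bb])
      also have "\<dots> = (\<integral>\<^sup>+i. ennreal (measure (\<mu> (i, \<omega>)) B) \<partial>\<Lambda>)"
        by (rule nn_integral_cong) (rule emeasure_\<mu>)
      also have "\<dots> = ennreal (\<integral>i. measure (\<mu> (i, \<omega>)) B \<partial>\<Lambda>)"
        using elim(2) B by (intro nn_integral_eq_integral) auto
      also have "\<dots> = emeasure (distr \<Lambda> borel (\<lambda>i. f (i, \<omega>))) B"
        using elim(2) B by (simp add: emeasure_distr[OF f_meas Bb] index.emeasure_eq_measure)
      finally show "emeasure (distr \<Lambda> borel (\<lambda>i. f (i, \<omega>))) B =
        emeasure (\<Lambda> \<bind> (\<lambda>i. \<mu> (i, \<omega>))) B" by simp
    next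
      show "sets (\<Lambda> \<bind> (\<lambda>i. \<mu> (i, \<omega>))) = sigma_sets UNIV H"
        using sets_bind[of \<Lambda> "\<lambda>i. \<mu> (i, \<omega>)" borel] \<mu>_space index.not_empty H(4) by simp
    next
      show "emeasure (distr \<Lambda> borel (\<lambda>i. f (i, \<omega>))) UNIV \<noteq> \<infinity>"
        by (simp add: emeasure_distr[OF f_meas] index.emeasure_eq_measure)
    qed (use H in auto)
  qed
qed

end
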